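(* Let $n \geq 1$ be an integer and let $St_n$ be the star graph on $n$ vertices. Then the graphical Stirling number of its Mycielskian $M(St_n)$ for exactly $2n$ parts is \[ B(M(St_n); 2n) = 2n^2 - 3n + 3 . \]
   Context: For a finite simple graph $G=(V,E)$, a proper partition of $G$ is a partition of $V$ into non-empty, pairwise disjoint subsets (parts), each of which is an independent set of $G$ (no two vertices in the same part are adjacent). The graphical Stirling number $B(G;k)$ is the number of proper partitions of $G$ into exactly $k$ parts. The star $St_n$ on $n$ vertices has a center $c$ adjacent to $n-1$ leaves $v_1,\dots,v_{n-1}$, and no other edges. Its Mycielskian $M(St_n)$ is the graph on the $2n+1$ vertices $c, v_1,\dots,v_{n-1}, c', v_1',\dots,v_{n-1}', u$ whose edges are exactly: $c v_i$, $c v_i'$, $c' v_i$, and $u v_i'$ for $1\le i\le n-1$, together with $u c'$. *)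

theory Defs
  imports "HOL-Library.Disjoint_Sets" "Graph_Theory.Pair_Digraph"
begin

text \<open>
  Finite simple graphs are the instances of the locale \<^locale>\<open>pair_graph\<close>: finite, loop-free
  and symmetric, so that an undirected edge between \<open>x\<close> and \<open>y\<close> is the pair of arcs
  \<open>(x, y)\<close> and \<open>(y, x)\<close>.
\<close>

definition independent_set :: "'a pair_pre_digraph \<Rightarrow> 'a set \<Rightarrow> bool" where
  "independent_set G S \<longleftrightarrow> S \<subseteq> pverts G \<and> (\<forall>x\<in>S. \<forall>y\<in>S. (x, y) \<notin> parcs G)"

definition proper_partition :: "'a pair_pre_digraph \<Rightarrow> 'a set set \<Rightarrow> bool" where
  "proper_partition G P \<longleftrightarrow> partition_on (pverts G) P \<and> (\<forall>S\<in>P. independent_set G S)"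

definition graphical_stirling :: "'a pair_pre_digraph \<Rightarrow> nat \<Rightarrow> nat" where
  "graphical_stirling G k = card {P. proper_partition G P \<and> card P = k}"

datatype star_vertex = Center | Leaf nat

definition star :: "nat \<Rightarrow> star_vertex pair_pre_digraph" where
  "star n = \<lparr> pverts = insert Center (Leaf ` {1..<n}),
     parcs = {(Center, Leaf i) | i. i \<in> {1..<n}} \<union> {(Leaf i, Center) | i. i \<in> {1..<n}} \<rparr>"

datatype 'a mycielski_vertex = Orig 'a | Copy 'a | Apex

definition mycielskian :: "'a pair_pre_digraph \<Rightarrow> 'a mycielski_vertex pair_pre_digraph" where
  "mycielskian G = \<lparr> pverts = Orig ` pverts G \<union> Copy ` pverts G \<union> {Apex},
     parcs = {(Orig x, Orig y) | x y. (x, y) \<in> parcs G}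
       \<union> {(Orig x, Copy y) | x y. (x, y) \<in> parcs G}
       \<union> {(Copy x, Orig y) | x y. (x, y) \<in> parcs G}
       \<union> {(Copy x, Apex) | x. x \<in> pverts G}
       \<union> {(Apex, Copy x) | x. x \<in> pverts G} \<rparr>"

lemma pair_graph_star: "pair_graph (star n)"
  by unfold_locales (auto simp: star_def symmetric_def sym_def)

lemma pair_graph_mycielskian:
  assumes "pair_graph G"
  shows "pair_graph (mycielskian G)"
proof -
  interpret pair_graph G by fact
  have "finite (parcs (mycielskian G))"
  proof (rule finite_subset)
    show "parcs (mycielskian G) \<subseteq> pverts (mycielskian G) \<times> pverts (mycielskian G)"
      by (auto simp: mycielskian_def dest: in_arcsD1 in_arcsD2)
    show "finite (pverts (mycielskian G) \<times> pverts (mycielskian G))"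
      using pair_finite_verts by (simp add: mycielskian_def)
  qed
  then show ?thesis
    using pair_finite_verts
    by unfold_locales
      (auto simp: mycielskian_def symmetric_def sym_def
        dest: in_arcsD1 in_arcsD2 arcs_symmetric no_loops')
qed

lemma card_pverts_star: "n \<ge> 1 \<Longrightarrow> card (pverts (star n)) = n"
  by (simp add: star_def card_insert_if image_iff card_image inj_on_def)

lemma pverts_mycielskian_star:
  "pverts (mycielskian (star n)) =
     {Orig Center, Copy Center, Apex}
     \<union> (\<lambda>i. Orig (Leaf i)) ` {1..<n} \<union> (\<lambda>i. Copy (Leaf i)) ` {1..<n}"
  by (auto simp: mycielskian_def star_def)

lemma parcs_mycielskian_star:
  fixes n :: nat
  defines "E \<equiv> (\<Union>i\<in>{1..<n}. {(Orig Center, Orig (Leaf i)), (Orig Center, Copy (Leaf i)),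
                             (Copy Center, Orig (Leaf i)), (Apex, Copy (Leaf i))})
               \<union> {(Apex, Copy Center)}"
  shows "parcs (mycielskian (star n)) = E \<union> E\<inverse>"
  by (auto simp: E_def mycielskian_def star_def)

end

theory Submission
  imports Defs
begin

text \<open>
  A partition of a set of \<open>N\<close> elements into \<open>N - 1\<close> parts merges exactly one pair of elements and
  leaves all others alone, because the surplus \<open>\<bar>S\<bar> - 1\<close>, added up over the parts \<open>S\<close>, is \<open>1\<close>.
  In a loop-free graph the partition is proper iff the merged pair is not an edge. So on \<open>N\<close>
  vertices, \<open>B(G; N - 1)\<close> is the number of non-edges, \<open>N choose 2\<close> minus the number of edges
  (lemma \<open>graphical_stirling_card_verts_minus_1\<close>, stated with arcs, where each edge counts
  twice).

  It remains to count. The Mycielskian of a graph with \<open>n\<close> vertices and \<open>m\<close> edges has \<open>2 n + 1\<close>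
  vertices and \<open>3 m + n\<close> edges, and the star has \<open>m = n - 1\<close>, which leaves
  \<open>n (2 n + 1) - (4 n - 3) = 2 n\<^sup>2 - 3 n + 3\<close> non-edges.
\<close>

definition merge_pair :: "'a set \<Rightarrow> 'a set \<Rightarrow> 'a set set" where
  "merge_pair V e = insert e ((\<lambda>x. {x}) ` (V - e))"

lemma partition_on_merge_pair:
  assumes "e \<subseteq> V" "e \<noteq> {}"
  shows "partition_on V (merge_pair V e)"
  using assms by (auto simp: partition_on_def merge_pair_def disjoint_def)

lemma card_merge_pair:
  assumes "finite V" "e \<subseteq> V" "card e = 2"
  shows "Suc (card (merge_pair V e)) = card V"
proof -
  have fin: "finite e" using assms finite_subset by blast
  have "e \<notin> (\<lambda>x. {x}) ` (V - e)" using assms(3) by auto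
  then have "card (merge_pair V e) = Suc (card (V - e))"
    using assms(1) by (simp add: merge_pair_def card_image)
  moreover have "card (V - e) = card V - 2" using assms fin by (simp add: card_Diff_subset)
  moreover have "2 \<le> card V" using assms card_mono by metis
  ultimately show ?thesis by simp
qed

text \<open>The merged pair can be read off from the partition: it is the only part of size two.\<close>

lemma inj_on_merge_pair: "inj_on (merge_pair V) {e. card e = 2}"
proof (rule inj_onI)
  fix e f :: "'a set"
  assume "e \<in> {e. card e = 2}" "f \<in> {e. card e = 2}" and eq: "merge_pair V e = merge_pair V f"
  then have "card e = 2" by simp
  moreover have "e \<in> merge_pair V f" using eq by (auto simp: merge_pair_def)
  ultimately show "e = f" by (auto simp: merge_pair_def)
qed

text \<open>
  Every part has size at least one, so \<open>\<bar>S\<bar> - 1\<close> is a genuine difference, and these surpluses add up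
  to \<open>\<bar>V\<bar> - \<bar>P\<bar> = 1\<close>. Hence one part has size two and all others are singletons.
\<close>

lemma partition_on_one_part_fewer:
  assumes "finite V" and P: "partition_on V P" and card: "Suc (card P) = card V"
  obtains e where "e \<subseteq> V" "card e = 2" "P = merge_pair V e"
proof -
  have finP: "finite P" using finite_elements assms by blast
  have fin: "finite S" if "S \<in> P" for S
    using that P \<open>finite V\<close> by (metis Union_upper finite_subset partition_onD1)
  have pos: "card S > 0" if "S \<in> P" for S
    using that fin[OF that] P by (auto simp: card_gt_0_iff dest: partition_onD3)
  have "card V = (\<Sum>S\<in>P. card S)"
    using P fin by (auto simp: partition_on_def intro!: card_Union_disjoint)
  also have "\<dots> = (\<Sum>S\<in>P. (card S - 1) + 1)" using pos by (intro sum.cong) (auto simp: Suc_le_eq)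
  also have "\<dots> = (\<Sum>S\<in>P. card S - 1) + card P" by (subst sum.distrib) simp
  finally have "(\<Sum>S\<in>P. card S - 1) = 1" using card by simp
  then obtain e where e: "e \<in> P" "card e - 1 = 1"
    and rest: "\<And>S. S \<in> P \<Longrightarrow> S \<noteq> e \<Longrightarrow> card S - 1 = 0"
    unfolding sum_eq_1_iff[OF finP] by metis
  have sub: "e \<subseteq> V" using e P by (auto dest: partition_onD1)
  have "P = merge_pair V e"
  proof
    show "P \<subseteq> merge_pair V e"
    proof
      fix S assume S: "S \<in> P"
      show "S \<in> merge_pair V e"
      proof (cases "S = e")
        case False
        with rest[OF S] pos[OF S] have "card S = 1" by simp
        then obtain x where x: "S = {x}" by (auto simp: card_1_singleton_iff)
        have "S \<inter> e = {}" using P S e False by (auto simp: partition_on_def disjoint_def)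
        then show ?thesis using x S P by (auto simp: merge_pair_def dest: partition_onD1)
      qed (simp add: merge_pair_def)
    qed
  next
    show "merge_pair V e \<subseteq> P"
    proof
      fix S assume "S \<in> merge_pair V e"
      then consider "S = e" | x where "S = {x}" "x \<in> V" "x \<notin> e" by (auto simp: merge_pair_def)
      then show "S \<in> P"
      proof cases
        case 2
        then obtain T where T: "T \<in> P" "x \<in> T" using P by (auto dest: partition_onD1)
        then have "card T = 1" using rest[of T] pos[of T] 2 by fastforce
        then have "T = {x}" using T by (auto simp: card_1_singleton_iff)
        then show ?thesis using T 2 by simp
      qed (use e in simp)
    qed
  qed
  then show thesis using that sub e by auto
qed

lemma card_symmetric_irreflexive:
  assumes "finite R" "sym R" "irrefl R"
  shows "card R = 2 * card ((\<lambda>(x, y). {x, y}) ` R)"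
proof -
  let ?f = "\<lambda>(x, y). {x, y}"
  have fibre: "card {p \<in> R. ?f p = e} = 2" if "e \<in> ?f ` R" for e
  proof -
    from that obtain x y where xy: "(x, y) \<in> R" "e = {x, y}" by auto
    then have "x \<noteq> y" "(y, x) \<in> R" using assms by (auto simp: irrefl_def dest: symD)
    then have "{p \<in> R. ?f p = e} = {(x, y), (y, x)}" using xy by (auto simp: doubleton_eq_iff)
    then show ?thesis using \<open>x \<noteq> y\<close> by simp
  qed
  have "card R = (\<Sum>e\<in>?f ` R. card {p \<in> R. ?f p = e})"
    using sum.image_gen[OF assms(1), of "\<lambda>_. 1::nat" ?f] by simp
  then show ?thesis using fibre by simp
qed

text \<open>
  Singletons are independent because there are no loops, so only the merged pair can fail to be.
\<close>

lemma (in pair_graph) proper_partitions_one_part_fewer: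
  assumes "Suc k = card (pverts G)"
  shows "{P. proper_partition G P \<and> card P = k} =
    merge_pair (pverts G) ` {e. independent_set G e \<and> card e = 2}"
proof (intro set_eqI iffI)
  fix P assume "P \<in> {P. proper_partition G P \<and> card P = k}"
  then have P: "proper_partition G P" "Suc (card P) = card (pverts G)" using assms by auto
  then have "partition_on (pverts G) P" by (simp add: proper_partition_def)
  from partition_on_one_part_fewer[OF pair_finite_verts this P(2)]
  obtain e where e: "card e = 2" "P = merge_pair (pverts G) e" by metis
  then have "independent_set G e" using P by (simp add: proper_partition_def merge_pair_def)
  with e show "P \<in> merge_pair (pverts G) ` {e. independent_set G e \<and> card e = 2}" by auto
next
  fix P assume "P \<in> merge_pair (pverts G) ` {e. independent_set G e \<and> card e = 2}"
  then obtain e where e: "independent_set G e" "card e = 2" "P = merge_pair (pverts G) e" by auto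
  have sub: "e \<subseteq> pverts G" using e by (simp add: independent_set_def)
  have "independent_set G S" if "S \<in> P" for S
    using that e no_loops' by (auto simp: merge_pair_def independent_set_def)
  moreover have "partition_on (pverts G) P"
    using e sub partition_on_merge_pair[OF sub] by fastforce
  moreover have "card P = k" using card_merge_pair[OF pair_finite_verts sub e(2)] e assms by simp
  ultimately show "P \<in> {P. proper_partition G P \<and> card P = k}"
    by (simp add: proper_partition_def)
qed

text \<open>
  The factor two comes from counting ordered pairs: \<open>Suc k * k\<close> is the number of pairs of distinct
  vertices, and each pair is either an arc or one of the two orderings of an independent pair.
\<close>

lemma (in pair_graph) graphical_stirling_card_verts_minus_1:
  assumes V: "Suc k = card (pverts G)"
  shows "2 * graphical_stirling G k + card (parcs G) = Suc k * k"
proof -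
  let ?V = "pverts G" and ?I = "{e. independent_set G e \<and> card e = 2}"
  define R where "R = {(x, y). x \<in> ?V \<and> y \<in> ?V \<and> x \<noteq> y \<and> (x, y) \<notin> parcs G}"
  have split: "?V \<times> ?V = (R \<union> parcs G) \<union> (\<lambda>x. (x, x)) ` ?V"
    by (auto simp: R_def dest: in_arcsD1 in_arcsD2)
  have finR: "finite R" by (rule finite_subset[of _ "?V \<times> ?V"]) (auto simp: R_def)
  have "card (?V \<times> ?V) = card (R \<union> parcs G) + card ((\<lambda>x. (x, x)) ` ?V)"
    unfolding split using finR no_loops' by (intro card_Un_disjoint) (auto simp: R_def)
  also have "card (R \<union> parcs G) = card R + card (parcs G)"
    using finR by (intro card_Un_disjoint) (auto simp: R_def)
  also have "card ((\<lambda>x. (x, x)) ` ?V) = card ?V" by (intro card_image) (auto simp: inj_on_def)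
  finally have count: "card R + card (parcs G) = Suc k * k"
    unfolding card_cartesian_product V[symmetric] by simp
  have "(\<lambda>(x, y). {x, y}) ` R = ?I"
  proof (intro set_eqI iffI)
    fix e assume "e \<in> (\<lambda>(x, y). {x, y}) ` R"
    then show "e \<in> ?I"
      using no_loops' by (auto simp: R_def independent_set_def dest: arcs_symmetric)
  next
    fix e assume "e \<in> ?I"
    then obtain x y where "e = {x, y}" "x \<noteq> y" "independent_set G e" by (auto simp: card_2_iff)
    then have "(x, y) \<in> R" by (auto simp: R_def independent_set_def)
    with \<open>e = {x, y}\<close> show "e \<in> (\<lambda>(x, y). {x, y}) ` R" by auto
  qed
  moreover have "card R = 2 * card ((\<lambda>(x, y). {x, y}) ` R)"
    using finR by (intro card_symmetric_irreflexive)
      (auto simp: R_def sym_def irrefl_def dest: arcs_symmetric)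
  moreover have "graphical_stirling G k = card ?I"
    unfolding graphical_stirling_def proper_partitions_one_part_fewer[OF V]
    by (intro card_image inj_on_subset[OF inj_on_merge_pair]) auto
  ultimately show ?thesis using count by simp
qed

lemma (in pair_graph) card_pverts_mycielskian:
  "card (pverts (mycielskian G)) = 2 * card (pverts G) + 1"
proof -
  have "card (Orig ` pverts G \<union> Copy ` pverts G) = card (Orig ` pverts G) + card (Copy ` pverts G)"
    by (intro card_Un_disjoint) auto
  then show ?thesis
    by (simp add: mycielskian_def card_insert_if image_iff card_image inj_on_def)
qed

text \<open>
  Each arc of \<open>G\<close> appears between originals and, in both directions of copying, between an original
  and a copy; each vertex contributes the two arcs between its copy and the apex.
\<close>

lemma (in pair_graph) card_parcs_mycielskian:
  "card (parcs (mycielskian G)) = 3 * card (parcs G) + 2 * card (pverts G)"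
proof -
  let ?A = "parcs G" and ?V = "pverts G"
  let ?oo = "map_prod Orig Orig ` ?A" and ?oc = "map_prod Orig Copy ` ?A"
    and ?co = "map_prod Copy Orig ` ?A"
    and ?ca = "(\<lambda>x. (Copy x, Apex :: 'a mycielski_vertex)) ` ?V"
    and ?ac = "(\<lambda>x. (Apex :: 'a mycielski_vertex, Copy x)) ` ?V"
  have "parcs (mycielskian G) = ?oo \<union> (?oc \<union> (?co \<union> (?ca \<union> ?ac)))"
    by (auto simp: mycielskian_def image_iff Bex_def)
  also have "card \<dots> = card ?oo + (card ?oc + (card ?co + (card ?ca + card ?ac)))"
    by (subst card_Un_disjoint, force, force, force)+ simp
  also have "\<dots> = 3 * card ?A + 2 * card ?V"
    by (simp add: card_image inj_on_def map_prod_def split_beta prod_eq_iff)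
  finally show ?thesis .
qed

lemma card_parcs_star: "card (parcs (star n)) = 2 * (n - 1)"
proof -
  have "parcs (star n) = (\<lambda>i. (Center, Leaf i)) ` {1..<n} \<union> (\<lambda>i. (Leaf i, Center)) ` {1..<n}"
    by (auto simp: star_def)
  also have "card \<dots> = card ((\<lambda>i. (Center, Leaf i)) ` {1..<n}) + card ((\<lambda>i. (Leaf i, Center)) ` {1..<n})"
    by (intro card_Un_disjoint) auto
  also have "\<dots> = 2 * (n - 1)" by (simp add: card_image inj_on_def)
  finally show ?thesis .
qed

theorem corollary6:
  fixes n :: nat
  assumes "n \<ge> 1"
  shows "int (graphical_stirling (mycielskian (star n)) (2 * n)) = 2 * (int n)^2 - 3 * int n + 3"
proof -
  interpret S: pair_graph "star n" by (rule pair_graph_star)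
  interpret M: pair_graph "mycielskian (star n)" by (rule pair_graph_mycielskian[OF pair_graph_star])
  let ?B = "graphical_stirling (mycielskian (star n)) (2 * n)"
  have "Suc (2 * n) = card (pverts (mycielskian (star n)))"
    using assms by (simp add: S.card_pverts_mycielskian card_pverts_star)
  from M.graphical_stirling_card_verts_minus_1[OF this]
  have "2 * ?B + (6 * (n - 1) + 2 * n) = Suc (2 * n) * (2 * n)"
    using assms by (simp add: S.card_parcs_mycielskian card_parcs_star card_pverts_star)
  then have "int (2 * ?B + (6 * (n - 1) + 2 * n)) = int (Suc (2 * n) * (2 * n))" by (rule arg_cong)
  then show ?thesis using assms by (simp add: of_nat_diff algebra_simps power2_eq_square)
qed

end
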